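(* Let $X$ be a sieve-complete space, $Y$ a $\mu$-space, and let $F\colon\mathcal{K}(X)\to\mathcal{K}(Y)$ be a monotone set tri-quotient map. Then $Y$ is sieve-complete and $l(Y)\leq l(X)$.
   Context: All spaces are completely regular. $\mathcal{K}(X)$ is the set of all compact subsets of $X$; $\mathcal{T}(X)$ is the topology of $X$. For $\mathcal{S}(X)\subset 2^X$, a map $F\colon\mathcal{S}(X)\to 2^Y$ is monotone if $K\subset L$ implies $F(K)\subset F(L)$. It is set tri-quotient if there is a map $s\colon\mathcal{T}(X)\to\mathcal{T}(Y)$ such that: (str1) $s(U)\subset\bigcup\{F(K):K\in\mathcal{S}(X),\ K\subset U\}$; (str2) $s(X)=Y$; (str3) $U\subset V$ implies $s(U)\subset s(V)$; (str4) if $y\in s(U)$ and $\mathcal{W}$ is a cover of $\bigcup\{K\in F^{-1}(y):K\subset U\}$ by open subsets of $X$, then $y\in s(\bigcup\mathcal{E})$ for some finite $\mathcal{E}\subset\mathcal{W}$; here $F^{-1}(y)=\{K\in\mathcal{S}(X):y\in F(K)\}$. A space is a $\mu$-space if every closed bounded subset is compact, where $A\subset X$ is bounded if every continuous real-valued function on $X$ is bounded on $A$. A sieve on $X$ is a sequence of open covers $\{U_\alpha:\alpha\in A_n\}_{n\in\mathbb{N}}$ of $X$ with maps $\pi_n\colon A_{n+1}\to A_n$ such that $U_\alpha=\bigcup\{U_\beta:\beta\in\pi_n^{-1}(\alpha)\}$ for all $n$ and $\alpha\in A_n$; a $\pi$-chain is a sequence $(\alpha_n)$ with $\alpha_n\in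 A_n$ and $\pi_n(\alpha_{n+1})=\alpha_n$. The sieve is complete if for every $\pi$-chain $(\alpha_n)$, every filter base on $X$ which meshes with $\{U_{\alpha_n}\}$ (every member meets every $U_{\alpha_n}$) has a cluster point in $X$. A space with a complete sieve is sieve-complete. $l(X)$ denotes the Lindelöf number of $X$. *)

theory Defs
  imports "HOL-Analysis.Analysis"
begin

text \<open>Standing convention: spaces are completely regular (Tychonoff: completely regular and T1).\<close>
definition tychonoff :: "'a topology \<Rightarrow> bool" where
  "tychonoff X \<longleftrightarrow> completely_regular_space X \<and> t1_space X"

definition boundedin_space :: "'a topology \<Rightarrow> 'a set \<Rightarrow> bool" where
  "boundedin_space X A \<longleftrightarrow> A \<subseteq> topspace X \<and>
     (\<forall>f. continuous_map X euclideanreal f \<longrightarrow> bounded (f ` A))"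

definition mu_space :: "'a topology \<Rightarrow> bool" where
  "mu_space X \<longleftrightarrow> (\<forall>A. closedin X A \<and> boundedin_space X A \<longrightarrow> compactin X A)"

definition is_sieve :: "'a topology \<Rightarrow> (nat \<Rightarrow> 'i set) \<Rightarrow> (nat \<Rightarrow> 'i \<Rightarrow> 'a set)
    \<Rightarrow> (nat \<Rightarrow> 'i \<Rightarrow> 'i) \<Rightarrow> bool" where
  "is_sieve X I U p \<longleftrightarrow>
     (\<forall>n. \<forall>\<alpha>\<in>I n. openin X (U n \<alpha>)) \<and>
     (\<forall>n. \<Union>(U n ` I n) = topspace X) \<and>
     (\<forall>n. \<forall>\<beta>\<in>I (Suc n). p n \<beta> \<in> I n) \<and>
     (\<forall>n. \<forall>\<alpha>\<in>I n. U n \<alpha> = \<Union>{U (Suc n) \<beta> | \<beta>. \<beta> \<in> I (Suc n) \<and> p n \<beta> = \<alpha>})"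

definition pi_chain :: "(nat \<Rightarrow> 'i set) \<Rightarrow> (nat \<Rightarrow> 'i \<Rightarrow> 'i) \<Rightarrow> (nat \<Rightarrow> 'i) \<Rightarrow> bool" where
  "pi_chain I p c \<longleftrightarrow> (\<forall>n. c n \<in> I n) \<and> (\<forall>n. p n (c (Suc n)) = c n)"

definition filter_base_on :: "'a topology \<Rightarrow> 'a set set \<Rightarrow> bool" where
  "filter_base_on X \<B> \<longleftrightarrow> \<B> \<noteq> {} \<and> (\<forall>B\<in>\<B>. B \<noteq> {} \<and> B \<subseteq> topspace X) \<and>
     (\<forall>B1\<in>\<B>. \<forall>B2\<in>\<B>. \<exists>B3\<in>\<B>. B3 \<subseteq> B1 \<inter> B2)"

definition complete_sieve :: "'a topology \<Rightarrow> (nat \<Rightarrow> 'i set) \<Rightarrow> (nat \<Rightarrow> 'i \<Rightarrow> 'a set)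
    \<Rightarrow> (nat \<Rightarrow> 'i \<Rightarrow> 'i) \<Rightarrow> bool" where
  "complete_sieve X I U p \<longleftrightarrow> is_sieve X I U p \<and>
     (\<forall>c \<B>. pi_chain I p c \<and> filter_base_on X \<B> \<and>
        (\<forall>B\<in>\<B>. \<forall>n. B \<inter> U n (c n) \<noteq> {}) \<longrightarrow>
        (\<exists>x\<in>topspace X. \<forall>B\<in>\<B>. x \<in> X closure_of B))"

definition sieve_complete_with :: "'a topology \<Rightarrow> 'i itself \<Rightarrow> bool" where
  "sieve_complete_with X _ \<longleftrightarrow>
     (\<exists>(I :: nat \<Rightarrow> 'i set) U p. complete_sieve X I U p)"

text \<open>\<open>lindelof_le X K\<close>: every open cover of X has a subcover of cardinality at most |K|;
  for infinite K this says l(X) \<le> |K|.\<close>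
definition lindelof_le :: "'a topology \<Rightarrow> 'c set \<Rightarrow> bool" where
  "lindelof_le X K \<longleftrightarrow> (\<forall>\<U>. (\<forall>U\<in>\<U>. openin X U) \<and> topspace X \<subseteq> \<Union>\<U> \<longrightarrow>
      (\<exists>\<V>\<subseteq>\<U>. topspace X \<subseteq> \<Union>\<V> \<and> \<V> \<lesssim> K))"

definition monotone_on_compacts :: "'a topology \<Rightarrow> ('a set \<Rightarrow> 'b set) \<Rightarrow> bool" where
  "monotone_on_compacts X F \<longleftrightarrow>
     (\<forall>K L. compactin X K \<and> compactin X L \<and> K \<subseteq> L \<longrightarrow> F K \<subseteq> F L)"

definition maps_compacts :: "'a topology \<Rightarrow> 'b topology \<Rightarrow> ('a set \<Rightarrow> 'b set) \<Rightarrow> bool" where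
  "maps_compacts X Y F \<longleftrightarrow> (\<forall>K. compactin X K \<longrightarrow> compactin Y (F K))"

text \<open>Set tri-quotient map \<open>F : \<K>(X) \<rightarrow> 2^Y\<close>; \<open>s\<close> is only relevant on open sets.\<close>
definition set_tri_quotient :: "'a topology \<Rightarrow> 'b topology \<Rightarrow> ('a set \<Rightarrow> 'b set) \<Rightarrow> bool" where
  "set_tri_quotient X Y F \<longleftrightarrow> (\<exists>s :: 'a set \<Rightarrow> 'b set.
     (\<forall>U. openin X U \<longrightarrow> openin Y (s U)) \<and>
     (\<forall>U. openin X U \<longrightarrow> s U \<subseteq> \<Union>{F K | K. compactin X K \<and> K \<subseteq> U}) \<and>
     s (topspace X) = topspace Y \<and>
     (\<forall>U V. openin X U \<and> openin X V \<and> U \<subseteq> V \<longrightarrow> s U \<subseteq> s V) \<and>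
     (\<forall>U y \<W>. openin X U \<and> y \<in> s U \<and> (\<forall>W\<in>\<W>. openin X W) \<and>
        \<Union>{K. compactin X K \<and> y \<in> F K \<and> K \<subseteq> U} \<subseteq> \<Union>\<W> \<longrightarrow>
        (\<exists>\<E>. finite \<E> \<and> \<E> \<subseteq> \<W> \<and> y \<in> s (\<Union>\<E>))))"

end

theory Submission
  imports Defs
begin

text \<open>
  Call a decreasing sequence of sets complete if every filter base meshing with it has a cluster
  point; its core is the intersection of the closures. By Koenig's lemma, the unions of finite
  subsets \<open>E\<^sub>n\<close> of the levels of a complete sieve form a complete sequence \<open>W\<^sub>n\<close> when the parents of
  \<open>E\<^sub>n\<^sub>+\<^sub>1\<close> lie in \<open>E\<^sub>n\<close>. The core of \<open>W\<close> is compact and has the \<open>W\<^sub>n\<close> as a neighbourhood base, so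
  compact sets \<open>K\<^sub>n \<subseteq> W\<^sub>n\<close> together with the core form a compact set \<open>L\<close>. Hence every selection
  \<open>y\<^sub>n \<in> s(W\<^sub>n)\<close> lies in the compact set \<open>F(L)\<close>. In a \<open>\<mu>\<close>-space this makes the core of the sequence
  \<open>s(W\<^sub>n)\<close> bounded, hence compact, and the sequence itself complete. So the sets \<open>s(W)\<close>, indexed by
  the histories \<open>E\<^sub>0, \<dots>, E\<^sub>n\<close>, form a complete sieve on \<open>Y\<close>.

  For the Lindelof number \<open>\<kappa>\<close> of \<open>X\<close>, thin the sieve of \<open>X\<close> to at most \<open>\<kappa>\<close> members on each level.
  Given an open cover of \<open>Y\<close>, every \<open>y\<close> lies in some \<open>s(W)\<close> covered by finitely many members, and
  there are at most \<open>\<kappa>\<close> such \<open>W\<close>.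
\<close>

section \<open>Complete sequences\<close>

text \<open>This is what completeness of a sieve says about a single chain, freed from the indices
  so that it also applies to the sets \<open>s (W n)\<close> in \<open>Y\<close>.\<close>

definition complete_seq :: "'a topology \<Rightarrow> (nat \<Rightarrow> 'a set) \<Rightarrow> bool" where
  "complete_seq X W \<longleftrightarrow> decseq W \<and> (\<forall>n. W n \<subseteq> topspace X) \<and>
     (\<forall>\<B>. filter_base_on X \<B> \<and> (\<forall>B\<in>\<B>. \<forall>n. B \<inter> W n \<noteq> {}) \<longrightarrow>
        (\<exists>x\<in>topspace X. \<forall>B\<in>\<B>. x \<in> X closure_of B))"

definition core :: "'a topology \<Rightarrow> (nat \<Rightarrow> 'a set) \<Rightarrow> 'a set" where
  "core X W = (\<Inter>n. X closure_of W n)"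

lemma in_core: "x \<in> core X W \<longleftrightarrow> (\<forall>n. x \<in> X closure_of W n)"
  by (simp add: core_def)

lemma closure_of_meets_open:
  "\<lbrakk>x \<in> X closure_of S; openin X T; x \<in> T\<rbrakk> \<Longrightarrow> \<exists>y. y \<in> S \<and> y \<in> T"
  unfolding in_closure_of by meson

lemma closedin_core: "closedin X (core X W)"
  unfolding core_def by (intro closedin_Inter) auto

lemma complete_seqD:
  assumes "complete_seq X W" "filter_base_on X \<B>" "\<And>B n. B \<in> \<B> \<Longrightarrow> B \<inter> W n \<noteq> {}"
  obtains x where "x \<in> topspace X" "\<And>B. B \<in> \<B> \<Longrightarrow> x \<in> X closure_of B"
proof -
  have "\<exists>x\<in>topspace X. \<forall>B\<in>\<B>. x \<in> X closure_of B"
    by (rule assms(1)[unfolded complete_seq_def, THEN conjunct2, THEN conjunct2, rule_format])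
      (use assms(2,3) in auto)
  then show ?thesis using that by blast
qed

text \<open>Disjoint open sets around \<open>C\<close> and a point \<open>x\<close> outside it would
  keep \<open>x\<close> out of the closure of the one around \<open>C\<close>.\<close>

lemma regular_space_cluster:
  assumes "regular_space X" "closedin X C" "x \<in> topspace X"
    and "\<And>G. \<lbrakk>openin X G; C \<subseteq> G\<rbrakk> \<Longrightarrow> x \<in> X closure_of G"
  shows "x \<in> C"
proof (rule ccontr)
  assume "x \<notin> C"
  then obtain U V where "openin X U" "openin X V" "x \<in> U" "C \<subseteq> V" "disjnt U V"
    using assms(1-3) unfolding regular_space_def by (metis DiffI)
  moreover from this have "x \<in> X closure_of V"
    using assms(4) by blast
  ultimately show False
    by (auto simp: in_closure_of disjnt_iff)
qed

text \<open>A filter base living on the core need not mesh with the sequence, but the base of its open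
  neighbourhoods does, and by regularity both have the same cluster points.\<close>

lemma compactin_core:
  assumes "regular_space X" and W: "complete_seq X W"
  shows "compactin X (core X W)"
  unfolding compactin_def
proof (intro conjI allI impI)
  show "core X W \<subseteq> topspace X"
    by (rule closedin_subset[OF closedin_core])
next
  fix \<U> assume \<U>: "(\<forall>U\<in>\<U>. openin X U) \<and> core X W \<subseteq> \<Union>\<U>"
  show "\<exists>\<F>. finite \<F> \<and> \<F> \<subseteq> \<U> \<and> core X W \<subseteq> \<Union>\<F>"
  proof (rule ccontr)
    assume con: "\<not> ?thesis"
    \<comment> \<open>Without a finite subcover the sets \<open>core X W - \<Union>\<F>\<close> are
      nonempty. \<open>\<B>\<close> consists of their open neighbourhoods, which meet every
      \<open>W n\<close> because the core lies in the closure of \<open>W n\<close>.\<close>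
    define \<B> where "\<B> = {G. openin X G \<and> (\<exists>\<F>. finite \<F> \<and> \<F> \<subseteq> \<U> \<and> core X W - \<Union>\<F> \<subseteq> G)}"
    have mesh: "B \<inter> W n \<noteq> {}" if B\<B>: "B \<in> \<B>" for B n
    proof -
      obtain \<F> where \<F>: "finite \<F>" "\<F> \<subseteq> \<U>" "core X W - \<Union>\<F> \<subseteq> B" and B: "openin X B"
        using B\<B> unfolding \<B>_def by blast
      then obtain x where "x \<in> core X W - \<Union>\<F>"
        using con by blast
      then have "x \<in> X closure_of W n" "x \<in> B"
        using \<F> by (auto simp: in_core)
      then show ?thesis
        using closure_of_meets_open[OF _ B] by blast
    qed
    have "filter_base_on X \<B>"
      unfolding filter_base_on_def
    proof (intro conjI ballI)
      have "topspace X \<in> \<B>"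
        unfolding \<B>_def using closedin_core[of X W, THEN closedin_subset]
        by (auto intro!: exI[of _ "{}"])
      then show "\<B> \<noteq> {}" by blast
    next
      fix B assume "B \<in> \<B>" then show "B \<noteq> {}" "B \<subseteq> topspace X"
        using mesh[of B 0] by (auto simp: \<B>_def dest: openin_subset)
    next
      fix B1 B2 assume "B1 \<in> \<B>" "B2 \<in> \<B>"
      then obtain \<F>1 \<F>2 where "finite \<F>1" "\<F>1 \<subseteq> \<U>" "core X W - \<Union>\<F>1 \<subseteq> B1" "openin X B1"
         "finite \<F>2" "\<F>2 \<subseteq> \<U>" "core X W - \<Union>\<F>2 \<subseteq> B2" "openin X B2"
        by (auto simp: \<B>_def)
      then have "B1 \<inter> B2 \<in> \<B>"
        unfolding \<B>_def by (intro CollectI conjI openin_Int exI[of _ "\<F>1 \<union> \<F>2"]) auto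
      then show "\<exists>B3\<in>\<B>. B3 \<subseteq> B1 \<inter> B2" by blast
    qed
    then obtain x where x: "x \<in> topspace X" "\<And>B. B \<in> \<B> \<Longrightarrow> x \<in> X closure_of B"
      using complete_seqD[OF W] mesh by metis
    have *: "x \<in> core X W - \<Union>\<F>" if "finite \<F>" "\<F> \<subseteq> \<U>" for \<F>
    proof (rule regular_space_cluster[OF assms(1) _ x(1)])
      show "closedin X (core X W - \<Union>\<F>)"
        using \<U> that by (intro closedin_diff closedin_core openin_Union) auto
      show "x \<in> X closure_of G" if "openin X G" "core X W - \<Union>\<F> \<subseteq> G" for G
        using that x(2)[of G] \<open>finite \<F>\<close> \<open>\<F> \<subseteq> \<U>\<close> by (auto simp: \<B>_def)
    qed
    \<comment> \<open>The choice \<open>\<F> = {}\<close> puts \<open>x\<close> into the core, hence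
      into a member \<open>U\<close> of the cover; \<open>\<F> = {U}\<close> then puts it outside
      \<open>U\<close>.\<close>
    have "x \<in> core X W" using *[of "{}"] by simp
    then obtain U where "U \<in> \<U>" "x \<in> U" using \<U> by blast
    then show False using *[of "{U}"] by simp
  qed
qed

text \<open>Otherwise the sets \<open>W n - G\<close> form a filter base meshing with
  \<open>W\<close>; a cluster point of it lies in the core but, \<open>G\<close> being open, not in
  \<open>G\<close>.\<close>

lemma complete_seq_eventually_subset:
  assumes W: "complete_seq X W" and G: "openin X G" "core X W \<subseteq> G"
  shows "\<exists>n. W n \<subseteq> G"
proof (rule ccontr)
  assume con: "\<nexists>n. W n \<subseteq> G"
  have dec: "decseq W" and sub: "\<And>n. W n \<subseteq> topspace X"
    using W by (auto simp: complete_seq_def)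
  define \<B> where "\<B> = range (\<lambda>n. W n - G)"
  have ne: "W n - G \<noteq> {}" for n
    using con by auto
  have "filter_base_on X \<B>"
    unfolding filter_base_on_def
  proof (intro conjI ballI)
    show "\<B> \<noteq> {}" by (simp add: \<B>_def)
  next
    fix B assume "B \<in> \<B>" then show "B \<noteq> {}" "B \<subseteq> topspace X"
      using ne sub by (auto simp: \<B>_def)
  next
    fix B1 B2 assume "B1 \<in> \<B>" "B2 \<in> \<B>"
    then obtain m n where "B1 = W m - G" "B2 = W n - G" by (auto simp: \<B>_def)
    then have "W (max m n) - G \<subseteq> B1 \<inter> B2"
      using decseqD[OF dec, of m "max m n"] decseqD[OF dec, of n "max m n"] by auto
    then show "\<exists>B3\<in>\<B>. B3 \<subseteq> B1 \<inter> B2" by (auto simp: \<B>_def)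
  qed
  moreover have "B \<inter> W n \<noteq> {}" if B: "B \<in> \<B>" for B n
  proof -
    obtain m where "B = W m - G" using B by (auto simp: \<B>_def)
    then have "W (max m n) - G \<subseteq> B \<inter> W n"
      using decseqD[OF dec, of m "max m n"] decseqD[OF dec, of n "max m n"] by auto
    then show ?thesis using ne by blast
  qed
  ultimately obtain x where x: "x \<in> topspace X" "\<And>B. B \<in> \<B> \<Longrightarrow> x \<in> X closure_of B"
    using complete_seqD[OF W] by metis
  have "x \<in> X closure_of (W n - G)" for n
    using x(2) by (auto simp: \<B>_def)
  then have "x \<in> X closure_of W n" "x \<notin> G" for n
    using closure_of_meets_open[OF _ G(1)] closure_of_mono[of "W n - G" "W n" X] by blast+
  then have "x \<in> core X W" "x \<notin> G" by (auto simp: in_core)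
  then show False using G(2) by blast
qed

text \<open>Finitely many members of a cover contain the core, hence some \<open>W n\<close> and
  with it every \<open>K m\<close> with \<open>m \<ge> n\<close>. Only finitely many compact sets
  \<open>K m\<close> remain to be covered.\<close>

lemma complete_seq_compact_Un:
  assumes "regular_space X" and W: "complete_seq X W"
    and K: "\<And>n. compactin X (K n)" "\<And>n. K n \<subseteq> W n"
  shows "compactin X (core X W \<union> (\<Union>n. K n))"
  unfolding compactin_def
proof (intro conjI allI impI)
  show "core X W \<union> (\<Union>n. K n) \<subseteq> topspace X"
    using closedin_core[of X W, THEN closedin_subset] K(1)[THEN compactin_subset_topspace] by blast
next
  fix \<U> assume \<U>: "(\<forall>U\<in>\<U>. openin X U) \<and> core X W \<union> (\<Union>n. K n) \<subseteq> \<Union>\<U>"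
  then obtain \<F> where \<F>: "finite \<F>" "\<F> \<subseteq> \<U>" "core X W \<subseteq> \<Union>\<F>"
    using compactin_core[OF assms(1,2)] unfolding compactin_def by (metis Un_subset_iff)
  then have "openin X (\<Union>\<F>)"
    using \<U> by blast
  then obtain n where n: "W n \<subseteq> \<Union>\<F>"
    using complete_seq_eventually_subset[OF W] \<F>(3) by blast
  have "compactin X (\<Union>m<n. K m)"
    using K(1) by (intro compactin_Union) auto
  moreover have "(\<Union>m<n. K m) \<subseteq> \<Union>\<U>"
    using \<U> by blast
  ultimately obtain \<F>' where \<F>': "finite \<F>'" "\<F>' \<subseteq> \<U>" "(\<Union>m<n. K m) \<subseteq> \<Union>\<F>'"
    using \<U> unfolding compactin_def by meson
  have "K m \<subseteq> \<Union>\<F> \<union> \<Union>\<F>'" for m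
  proof (cases "m < n")
    case False
    then have "W m \<subseteq> W n"
      using W decseqD[of W n m] by (auto simp: complete_seq_def)
    then show ?thesis using n K(2)[of m] by blast
  qed (use \<F>' in blast)
  then show "\<exists>\<F>. finite \<F> \<and> \<F> \<subseteq> \<U> \<and> core X W \<union> (\<Union>n. K n) \<subseteq> \<Union>\<F>"
    using \<F> \<F>' by (intro exI[of _ "\<F> \<union> \<F>'"]) auto
qed

section \<open>Sequences of sets whose selections lie in compact sets\<close>

text \<open>The core is closed, so boundedness suffices. If \<open>f\<close> is unbounded on it, the
  open set where |f| > n meets the core and therefore \<open>V n\<close>, for each \<open>n\<close>;
  a selection from these intersections cannot lie in a compact set.\<close>

lemma mu_space_compactin_core:
  assumes "mu_space Y" and V: "\<And>n. openin Y (V n)"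
    and sel: "\<And>y. (\<And>n. y n \<in> V n) \<Longrightarrow> \<exists>C. compactin Y C \<and> range y \<subseteq> C"
  shows "compactin Y (core Y V)"
proof -
  have "bounded (f ` core Y V)" if f: "continuous_map Y euclideanreal f" for f
  proof (rule ccontr)
    assume unb: "\<not> bounded (f ` core Y V)"
    have "\<exists>y. y \<in> V n \<and> \<bar>f y\<bar> > real n" for n
    proof -
      obtain x where x: "x \<in> core Y V" "\<bar>f x\<bar> > real n"
        using unb by (force simp: bounded_iff not_le)
      have "openin Y {x \<in> topspace Y. f x \<in> {t. \<bar>t\<bar> > real n}}"
        using openin_continuous_map_preimage[OF f, of "{t. \<bar>t\<bar> > real n}"]
        by (simp add: open_Collect_less continuous_intros)
      moreover have "x \<in> Y closure_of V n" using x by (auto simp: in_core)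
      ultimately have "\<exists>y. y \<in> V n \<and> y \<in> {x \<in> topspace Y. f x \<in> {t. \<bar>t\<bar> > real n}}"
        using x(2) by (intro closure_of_meets_open[of x Y]) (auto simp: in_closure_of)
      then show ?thesis by blast
    qed
    then obtain y where y: "\<And>n. y n \<in> V n" "\<And>n. \<bar>f (y n)\<bar> > real n" by metis
    then obtain C where C: "compactin Y C" "range y \<subseteq> C" using sel by blast
    then have "compactin euclideanreal (f ` C)"
      using f image_compactin by blast
    then have "bounded (f ` C)"
      by (simp add: compact_imp_bounded)
    then obtain b where "\<And>c. c \<in> C \<Longrightarrow> \<bar>f c\<bar> \<le> b"
      by (auto simp: bounded_iff)
    then have "\<bar>f (y n)\<bar> \<le> b" for n using C(2) by blast
    moreover obtain n where "b < real n" using reals_Archimedean2 by blast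
    ultimately show False using y(2)[of n] by (metis less_le_trans not_less_iff_gr_or_eq)
  qed
  then have "boundedin_space Y (core Y V)"
    using closedin_subset[OF closedin_core] by (simp add: boundedin_space_def)
  then show ?thesis
    using assms(1) closedin_core unfolding mu_space_def by metis
qed

text \<open>A selection \<open>y\<close> avoiding \<open>G\<close> has a cluster point in the
  compact set around it. As \<open>V\<close> decreases, the tails of \<open>y\<close> lie in the
  sets \<open>V n\<close>, so this point is in the core and hence in \<open>G\<close>, which
  \<open>y\<close> never enters.\<close>

lemma selections_eventually_subset:
  assumes V: "decseq V"
    and sel: "\<And>y. (\<And>n. y n \<in> V n) \<Longrightarrow> \<exists>C. compactin Y C \<and> range y \<subseteq> C"
    and G: "openin Y G" "core Y V \<subseteq> G"
  shows "\<exists>n. V n \<subseteq> G"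
proof (rule ccontr)
  assume "\<nexists>n. V n \<subseteq> G"
  then have "\<forall>n. \<exists>y. y \<in> V n \<and> y \<notin> G" by blast
  then obtain y where y: "\<And>n. y n \<in> V n" "\<And>n. y n \<notin> G" by metis
  then obtain C where C: "compactin Y C" "range y \<subseteq> C" using sel by blast
  define D where "D n = Y closure_of (y ` {n..})" for n
  have "C \<inter> \<Inter>(range D) \<noteq> {}"
  proof -
    have "C \<inter> \<Inter>\<F> \<noteq> {}" if \<F>: "finite \<F>" "\<F> \<subseteq> range D" for \<F>
    proof -
      obtain N where N: "finite N" "\<F> = D ` N"
        using finite_subset_image[OF \<F>] by blast
      then obtain m where m: "\<And>n. n \<in> N \<Longrightarrow> n \<le> m"
        by (meson finite_nat_set_iff_bounded_le)
      have "y m \<in> D n" if "n \<in> N" for n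
      proof -
        have "y ` {n..} \<subseteq> D n"
          unfolding D_def using C(2) compactin_subset_topspace[OF C(1)]
          by (intro closure_of_subset) auto
        then show ?thesis using m[OF that] by auto
      qed
      then show ?thesis using C(2) N by auto
    qed
    moreover have "\<forall>A\<in>range D. closedin Y A" by (auto simp: D_def)
    ultimately show ?thesis
      using C(1) unfolding compactin_fip by meson
  qed
  then obtain z where z: "\<And>n. z \<in> D n" by blast
  have "y ` {n..} \<subseteq> V n" for n
    using y(1) decseqD[OF V] by blast
  then have "D n \<subseteq> Y closure_of V n" for n
    unfolding D_def by (rule closure_of_mono)
  then have "z \<in> core Y V" using z by (auto simp: in_core)
  then show False
    using closure_of_meets_open[OF z[of 0, unfolded D_def] G(1)] G(2) y(2) by blast
qed

text \<open>If a filter base has no cluster point, the complements of the closures of its members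
  cover the core. By compactness a member \<open>B\<close> below finitely many others has a closure
  disjoint from the core, so some \<open>V n\<close> misses \<open>B\<close>.\<close>

lemma complete_seqI:
  assumes V: "decseq V" "\<And>n. V n \<subseteq> topspace Y"
    and cpt: "compactin Y (core Y V)"
    and ev: "\<And>G. \<lbrakk>openin Y G; core Y V \<subseteq> G\<rbrakk> \<Longrightarrow> \<exists>n. V n \<subseteq> G"
  shows "complete_seq Y V"
  unfolding complete_seq_def
proof (intro conjI allI impI V)
  fix \<B> assume \<B>: "filter_base_on Y \<B> \<and> (\<forall>B\<in>\<B>. \<forall>n. B \<inter> V n \<noteq> {})"
  show "\<exists>x\<in>topspace Y. \<forall>B\<in>\<B>. x \<in> Y closure_of B"
  proof (rule ccontr)
    assume con: "\<not> ?thesis"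
    define \<O> where "\<O> = (\<lambda>B. topspace Y - Y closure_of B) ` \<B>"
    have "core Y V \<subseteq> \<Union>\<O>" "\<forall>G\<in>\<O>. openin Y G"
      using con compactin_subset_topspace[OF cpt] unfolding \<O>_def by (fastforce, auto)
    then obtain \<F> where "finite \<F>" "\<F> \<subseteq> \<O>" "core Y V \<subseteq> \<Union>\<F>"
      using cpt unfolding compactin_def by meson
    then obtain \<C> where \<C>: "finite \<C>" "\<C> \<subseteq> \<B>"
      "core Y V \<subseteq> (\<Union>B\<in>\<C>. topspace Y - Y closure_of B)"
      unfolding \<O>_def by (metis finite_subset_image)
    have "\<exists>B\<in>\<B>. \<forall>C\<in>\<C>. B \<subseteq> C"
      using \<C>(1,2)
    proof induction
      case empty then show ?case using \<B> by (auto simp: filter_base_on_def)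
    next
      case (insert C \<C>)
      then obtain B where B: "B \<in> \<B>" "\<forall>C\<in>\<C>. B \<subseteq> C" by auto
      then obtain B' where "B' \<in> \<B>" "B' \<subseteq> B \<inter> C"
        using insert \<B> unfolding filter_base_on_def by (metis insert_subset)
      then show ?case using B by auto
    qed
    then obtain B where B: "B \<in> \<B>" "\<And>C. C \<in> \<C> \<Longrightarrow> B \<subseteq> C" by blast
    have "core Y V \<subseteq> topspace Y - Y closure_of B"
    proof
      fix x assume "x \<in> core Y V"
      then obtain C where "C \<in> \<C>" "x \<in> topspace Y - Y closure_of C"
        using \<C>(3) by blast
      then show "x \<in> topspace Y - Y closure_of B"
        using closure_of_mono[OF B(2)] by blast
    qed
    then obtain n where "V n \<subseteq> topspace Y - Y closure_of B"
      using ev[of "topspace Y - Y closure_of B"] by (auto simp: openin_diff)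
    moreover have "B \<subseteq> Y closure_of B"
      using \<B> B(1) by (simp add: closure_of_subset filter_base_on_def)
    ultimately show False using \<B> B(1) by blast
  qed
qed

section \<open>Koenig's lemma and finite unions along a sieve\<close>

text \<open>An element with descendants at all later levels has a child of the same kind, by
  finiteness of the levels, so such elements can be chosen one after the other.\<close>

lemma koenig_inverse_limit:
  assumes fin: "\<And>n. finite (G n)" and ne: "\<And>n. G n \<noteq> {}"
    and p: "\<And>n. p n ` G (Suc n) \<subseteq> G n"
  shows "\<exists>c. (\<forall>n. c n \<in> G n) \<and> (\<forall>n. p n (c (Suc n)) = c n)"
proof -
  \<comment> \<open>\<open>desc k n\<close> is the image of \<open>G (n + k)\<close> in
    \<open>G n\<close>: the elements of \<open>G n\<close> with a descendant \<open>k\<close> levels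
    further on.\<close>
  define desc where "desc = rec_nat (\<lambda>n. G n) (\<lambda>_ D n. p n ` D (Suc n))"
  have desc0: "desc 0 n = G n" and descS: "desc (Suc k) n = p n ` desc k (Suc n)" for k n
    by (simp_all add: desc_def)
  have ne': "desc k n \<noteq> {}" for k n
    by (induction k arbitrary: n) (simp_all add: desc0 descS ne)
  have mono: "desc (Suc k) n \<subseteq> desc k n" for k n
  proof (induction k arbitrary: n)
    case 0 then show ?case using p by (simp add: desc0 descS)
  next
    case (Suc k) then show ?case by (metis descS image_mono)
  qed
  then have anti: "decseq (\<lambda>k. desc k n)" for n
    by (simp add: decseq_Suc_iff)
  have fin': "finite (desc k n)" for k n
    using fin[of n] decseqD[OF anti, of 0 k n] finite_subset desc0 by fastforce
  have inter: "(\<forall>k. \<exists>\<beta>\<in>desc k n. P \<beta>) \<Longrightarrow> \<exists>\<beta>. P \<beta> \<and> (\<forall>k. \<beta> \<in> desc k n)" for P n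
  proof (rule ccontr)
    assume h: "\<forall>k. \<exists>\<beta>\<in>desc k n. P \<beta>" and "\<nexists>\<beta>. P \<beta> \<and> (\<forall>k. \<beta> \<in> desc k n)"
    then obtain k where k: "\<And>\<beta>. P \<beta> \<Longrightarrow> \<beta> \<notin> desc (k \<beta>) n" by metis
    \<comment> \<open>By depth \<open>m\<close> every element of \<open>G n\<close> with property
      \<open>P\<close> would have dropped out.\<close>
    define m where "m = Max (insert 0 (k ` G n))"
    obtain \<beta> where \<beta>: "\<beta> \<in> desc m n" "P \<beta>" using h by blast
    then have "\<beta> \<in> G n" using decseqD[OF anti, of 0 m n] desc0 by auto
    then have "k \<beta> \<le> m" using fin by (simp add: m_def)
    then show False using k[OF \<beta>(2)] \<beta>(1) decseqD[OF anti] by blast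
  qed
  have "\<exists>c. \<forall>n. (\<forall>k. c n \<in> desc k n) \<and> p n (c (Suc n)) = c n"
  proof (rule dependent_nat_choice)
    show "\<exists>x. \<forall>k. x \<in> desc k 0"
      using inter[of 0 "\<lambda>_. True"] ne' by fastforce
  next
    fix \<alpha> n assume \<alpha>: "\<forall>k. \<alpha> \<in> desc k n"
    have "\<exists>\<beta>\<in>desc k (Suc n). p n \<beta> = \<alpha>" for k
      using \<alpha>[rule_format, of "Suc k"] by (auto simp: descS)
    then show "\<exists>\<beta>. (\<forall>k. \<beta> \<in> desc k (Suc n)) \<and> p n \<beta> = \<alpha>"
      using inter[of "Suc n" "\<lambda>\<beta>. p n \<beta> = \<alpha>"] by auto
  qed
  then show ?thesis by (metis desc0)
qed

lemma sieve_openin: "\<lbrakk>is_sieve X I U p; \<alpha> \<in> I n\<rbrakk> \<Longrightarrow> openin X (U n \<alpha>)"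
  unfolding is_sieve_def by (elim conjE) simp

lemma sieve_subset_parent:
  assumes sv: "is_sieve X I U p" and \<beta>: "\<beta> \<in> I (Suc n)"
  shows "U (Suc n) \<beta> \<subseteq> U n (p n \<beta>)"
proof -
  have "p n \<beta> \<in> I n" using assms unfolding is_sieve_def by blast
  then have "U n (p n \<beta>) = \<Union>{U (Suc n) \<gamma> | \<gamma>. \<gamma> \<in> I (Suc n) \<and> p n \<gamma> = p n \<beta>}"
    using sv unfolding is_sieve_def by blast
  also have "U (Suc n) \<beta> \<subseteq> \<dots>" using \<beta> by blast
  finally show ?thesis .
qed

lemma complete_sieveD:
  assumes "complete_sieve X I U p" "pi_chain I p c" "filter_base_on X \<B>"
    "\<forall>B\<in>\<B>. \<forall>n. B \<inter> U n (c n) \<noteq> {}"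
  shows "\<exists>x\<in>topspace X. \<forall>B\<in>\<B>. x \<in> X closure_of B"
  by (rule assms(1)[unfolded complete_sieve_def, THEN conjunct2, rule_format])
    (use assms(2-4) in \<open>intro conjI\<close>)

text \<open>Koenig's lemma turns a filter base meshing with the unions into one meshing with a
  single chain of indices, to which completeness of the sieve applies.\<close>

lemma complete_sieve_finite_unions:
  assumes S: "complete_sieve X I U p"
    and E: "\<And>n. finite (E n)" "\<And>n. E n \<subseteq> I n" "\<And>n. p n ` E (Suc n) \<subseteq> E n"
  shows "complete_seq X (\<lambda>n. \<Union>\<alpha>\<in>E n. U n \<alpha>)"
proof -
  have S': "is_sieve X I U p" using S unfolding complete_sieve_def by blast
  note Usub = sieve_subset_parent[OF S']
  show ?thesis
    unfolding complete_seq_def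
  proof (intro conjI allI impI)
    show "decseq (\<lambda>n. \<Union>\<alpha>\<in>E n. U n \<alpha>)"
    proof (rule decseq_SucI)
      show "(\<Union>\<beta>\<in>E (Suc n). U (Suc n) \<beta>) \<subseteq> (\<Union>\<alpha>\<in>E n. U n \<alpha>)" for n
        using Usub[of _ n] E(2)[of "Suc n"] E(3)[of n] by fastforce
    qed
    show "(\<Union>\<alpha>\<in>E n. U n \<alpha>) \<subseteq> topspace X" for n
      using sieve_openin[OF S', THEN openin_subset] E(2) by blast
  next
    fix \<B> assume \<B>: "filter_base_on X \<B> \<and> (\<forall>B\<in>\<B>. \<forall>n. B \<inter> (\<Union>\<alpha>\<in>E n. U n \<alpha>) \<noteq> {})"
    define G where "G n = {\<alpha>\<in>E n. \<forall>B\<in>\<B>. B \<inter> U n \<alpha> \<noteq> {}}" for n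
    have "\<exists>c. (\<forall>n. c n \<in> G n) \<and> (\<forall>n. p n (c (Suc n)) = c n)"
    proof (rule koenig_inverse_limit)
      show "finite (G n)" for n using E(1) by (simp add: G_def)
      show "p n ` G (Suc n) \<subseteq> G n" for n
        using E(2)[of "Suc n"] E(3)[of n] Usub[of _ n] unfolding G_def by fastforce
      show "G n \<noteq> {}" for n
      proof
        assume "G n = {}"
        then have "\<forall>\<alpha>\<in>E n. \<exists>B\<in>\<B>. B \<inter> U n \<alpha> = {}"
          unfolding G_def by blast
        then obtain b where b: "\<And>\<alpha>. \<alpha> \<in> E n \<Longrightarrow> b \<alpha> \<in> \<B> \<and> b \<alpha> \<inter> U n \<alpha> = {}"
          by metis
        \<comment> \<open>Were no index left, every \<open>U n \<alpha>\<close> with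
          \<open>\<alpha> \<in> E n\<close> would miss some \<open>b \<alpha> \<in> \<B>\<close>,
          and a member of \<open>\<B>\<close> inside all these finitely many sets would miss the
          whole union.\<close>
        have "finite A \<Longrightarrow> A \<subseteq> E n \<Longrightarrow> \<exists>B\<in>\<B>. \<forall>\<alpha>\<in>A. B \<inter> U n \<alpha> = {}" for A
        proof (induction rule: finite_induct)
          case empty then show ?case using \<B> by (auto simp: filter_base_on_def)
        next
          case (insert \<alpha> A)
          then obtain B where B: "B \<in> \<B>" "\<forall>\<alpha>\<in>A. B \<inter> U n \<alpha> = {}" by auto
          then obtain B' where "B' \<in> \<B>" "B' \<subseteq> B \<inter> b \<alpha>"
            using insert b \<B> unfolding filter_base_on_def by (metis insert_subset)
          moreover have "b \<alpha> \<inter> U n \<alpha> = {}" using b insert by blast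
          ultimately show ?case using B(2) by (intro bexI[of _ B']) auto
        qed
        from this[OF E(1) order_refl] obtain B where "B \<in> \<B>" "\<forall>\<alpha>\<in>E n. B \<inter> U n \<alpha> = {}"
          by blast
        then show False using \<B> by blast
      qed
    qed
    then obtain c where c: "\<And>n. c n \<in> G n" "\<And>n. p n (c (Suc n)) = c n" by blast
    have "c n \<in> I n" for n
      using c(1)[of n] E(2)[of n] by (auto simp: G_def)
    then have "pi_chain I p c"
      using c(2) by (simp add: pi_chain_def)
    moreover have "\<forall>B\<in>\<B>. \<forall>n. B \<inter> U n (c n) \<noteq> {}"
      using c(1) by (auto simp: G_def)
    ultimately show "\<exists>x\<in>topspace X. \<forall>B\<in>\<B>. x \<in> X closure_of B"
      using \<B> by (intro complete_sieveD[OF S, of c]) auto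
  qed
qed

section \<open>Tri-quotient images\<close>

text \<open>Fixes the witness \<open>s\<close>. Its values are open by \<open>s_open\<close>, and
  \<open>s_subset\<close>, \<open>s_topspace\<close>, \<open>s_mono\<close>, \<open>s_finite\<close>
  are (str1) to (str4) in this order.\<close>

locale mono_set_tri_quotient =
  fixes X :: "'a topology" and Y :: "'b topology"
    and F :: "'a set \<Rightarrow> 'b set" and s :: "'a set \<Rightarrow> 'b set"
  assumes regular: "regular_space X" and mu: "mu_space Y"
    and F_compact: "maps_compacts X Y F" and F_mono: "monotone_on_compacts X F"
    and s_open: "\<And>U. openin X U \<Longrightarrow> openin Y (s U)"
    and s_subset: "\<And>U. openin X U \<Longrightarrow> s U \<subseteq> \<Union>{F K | K. compactin X K \<and> K \<subseteq> U}"
    and s_topspace: "s (topspace X) = topspace Y"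
    and s_mono: "\<And>U V. \<lbrakk>openin X U; openin X V; U \<subseteq> V\<rbrakk> \<Longrightarrow> s U \<subseteq> s V"
    and s_finite: "\<And>U y \<W>. \<lbrakk>openin X U; y \<in> s U; \<forall>W\<in>\<W>. openin X W;
        \<Union>{K. compactin X K \<and> y \<in> F K \<and> K \<subseteq> U} \<subseteq> \<Union>\<W>\<rbrakk>
        \<Longrightarrow> \<exists>\<E>. finite \<E> \<and> \<E> \<subseteq> \<W> \<and> y \<in> s (\<Union>\<E>)"
begin

text \<open>By (str1) each \<open>y n\<close> lies in some \<open>F (K n)\<close> with
  \<open>K n\<close> a compact subset of \<open>W n\<close>. One compact set \<open>L\<close>
  contains all the \<open>K n\<close>, so by monotonicity \<open>F L\<close> contains all the
  \<open>y n\<close>.\<close>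

lemma selection_in_compact:
  assumes W: "complete_seq X W" "\<And>n. openin X (W n)" and y: "\<And>n. y n \<in> s (W n)"
  shows "\<exists>C. compactin Y C \<and> range y \<subseteq> C"
proof -
  have "\<exists>K. compactin X K \<and> K \<subseteq> W n \<and> y n \<in> F K" for n
    using s_subset[OF W(2)[of n]] y[of n] by blast
  then obtain K where K: "\<And>n. compactin X (K n)" "\<And>n. K n \<subseteq> W n" "\<And>n. y n \<in> F (K n)"
    by metis
  define L where "L = core X W \<union> (\<Union>n. K n)"
  have L: "compactin X L"
    unfolding L_def using complete_seq_compact_Un[OF regular W(1)] K by blast
  have "F (K n) \<subseteq> F L" for n
    using F_mono K(1) L unfolding monotone_on_compacts_def L_def by blast
  then show ?thesis
    using L F_compact K(3) unfolding maps_compacts_def by blast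
qed

lemma
  assumes W: "complete_seq X W" "\<And>n. openin X (W n)"
  shows compactin_core_image: "compactin Y (core Y (\<lambda>n. s (W n)))"
    and image_eventually_subset:
      "\<lbrakk>openin Y G; core Y (\<lambda>n. s (W n)) \<subseteq> G\<rbrakk> \<Longrightarrow> \<exists>n. s (W n) \<subseteq> G"
    and complete_seq_image: "complete_seq Y (\<lambda>n. s (W n))"
proof -
  have dec: "decseq (\<lambda>n. s (W n))"
    using W s_mono by (simp add: complete_seq_def decseq_Suc_iff)
  show cpt: "compactin Y (core Y (\<lambda>n. s (W n)))"
    using mu s_open[OF W(2)] selection_in_compact[OF W] by (rule mu_space_compactin_core)
  show ev: "\<exists>n. s (W n) \<subseteq> G" if "openin Y G" "core Y (\<lambda>n. s (W n)) \<subseteq> G" for G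
    using dec selection_in_compact[OF W] that by (rule selections_eventually_subset)
  show "complete_seq Y (\<lambda>n. s (W n))"
    using dec openin_subset[OF s_open[OF W(2)]] cpt ev by (rule complete_seqI)
qed

text \<open>This is (str4) for a family covering all of \<open>G\<close>, hence every compact subset
  of \<open>G\<close>.\<close>

lemma finite_refinement:
  assumes "openin X G" "y \<in> s G" "\<And>\<alpha>. \<alpha> \<in> A \<Longrightarrow> openin X (U \<alpha>)" "G \<subseteq> (\<Union>\<alpha>\<in>A. U \<alpha>)"
  shows "\<exists>E. finite E \<and> E \<subseteq> A \<and> y \<in> s (\<Union>\<alpha>\<in>E. U \<alpha>)"
proof -
  have "\<exists>\<E>. finite \<E> \<and> \<E> \<subseteq> U ` A \<and> y \<in> s (\<Union>\<E>)"
    using assms by (intro s_finite[of G]) auto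
  then show ?thesis
    by (metis finite_subset_image)
qed

lemma sieve_start:
  assumes "is_sieve X I U p" "y \<in> topspace Y"
  shows "\<exists>E. finite E \<and> E \<subseteq> I 0 \<and> y \<in> s (\<Union>\<alpha>\<in>E. U 0 \<alpha>)"
proof (rule finite_refinement[of "topspace X"])
  show "y \<in> s (topspace X)" using assms(2) s_topspace by simp
  show "topspace X \<subseteq> (\<Union>\<alpha>\<in>I 0. U 0 \<alpha>)" "\<And>\<alpha>. \<alpha> \<in> I 0 \<Longrightarrow> openin X (U 0 \<alpha>)"
    using assms(1) by (auto simp: is_sieve_def)
qed simp

text \<open>The children of the indices in \<open>E\<close> already cover the union, so (str4) can
  be applied to them alone; this keeps the parents of \<open>E'\<close> inside
  \<open>E\<close>.\<close>

lemma sieve_step: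
  assumes sv: "is_sieve X I U p" and E: "E \<subseteq> I n" "y \<in> s (\<Union>\<alpha>\<in>E. U n \<alpha>)"
  shows "\<exists>E'. finite E' \<and> E' \<subseteq> I (Suc n) \<and> p n ` E' \<subseteq> E \<and> y \<in> s (\<Union>\<beta>\<in>E'. U (Suc n) \<beta>)"
proof -
  have U: "openin X (U n \<alpha>)" "U n \<alpha> = \<Union>{U (Suc n) \<beta> | \<beta>. \<beta> \<in> I (Suc n) \<and> p n \<beta> = \<alpha>}"
    if "\<alpha> \<in> I n" for n \<alpha>
    using sv that by (auto simp: is_sieve_def)
  have "\<exists>E'. finite E' \<and> E' \<subseteq> {\<beta> \<in> I (Suc n). p n \<beta> \<in> E} \<and> y \<in> s (\<Union>\<beta>\<in>E'. U (Suc n) \<beta>)"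
  proof (rule finite_refinement[OF _ E(2)])
    show "openin X (\<Union>\<alpha>\<in>E. U n \<alpha>)" using U(1) E(1) by blast
    show "(\<Union>\<alpha>\<in>E. U n \<alpha>) \<subseteq> (\<Union>\<beta>\<in>{\<beta> \<in> I (Suc n). p n \<beta> \<in> E}. U (Suc n) \<beta>)"
    proof (rule UN_least)
      fix \<alpha> assume "\<alpha> \<in> E"
      then show "U n \<alpha> \<subseteq> (\<Union>\<beta>\<in>{\<beta> \<in> I (Suc n). p n \<beta> \<in> E}. U (Suc n) \<beta>)"
        using E(1) U(2)[of \<alpha> n] by blast
    qed
  qed (use U(1) in blast)
  then show ?thesis by blast
qed

section \<open>The sieve of histories on the target\<close>

text \<open>An index at level \<open>n\<close> codes a sequence \<open>E\<^sub>0, \<dots>, E\<^sub>n\<close> of finite sets with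
  \<open>E\<^sub>k \<subseteq> I k\<close>; the element \<open>\<alpha>\<close> of \<open>E\<^sub>k\<close> is recorded as the constant list of length \<open>k + 1\<close>.\<close>

definition level :: "('i list \<times> 'a set \<times> 'b set) set \<Rightarrow> nat \<Rightarrow> 'i set" where
  "level T k = {\<alpha>. (replicate (Suc k) \<alpha>, {}, {}) \<in> T}"

definition extend :: "nat \<Rightarrow> ('i list \<times> 'a set \<times> 'b set) set \<Rightarrow> 'i set
    \<Rightarrow> ('i list \<times> 'a set \<times> 'b set) set" where
  "extend n T E = T \<union> (\<lambda>\<alpha>. (replicate (Suc n) \<alpha>, {}, {})) ` E"

definition restrict_levels :: "nat \<Rightarrow> ('i list \<times> 'a set \<times> 'b set) set
    \<Rightarrow> ('i list \<times> 'a set \<times> 'b set) set" where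
  "restrict_levels n T = {t \<in> T. length (fst t) \<le> Suc n}"

text \<open>The whole history is kept because one finite set of indices may continue several others,
  while the parent map of a sieve must single out one. The bound on lengths lets restriction undo
  extension.\<close>

definition codes :: "(nat \<Rightarrow> 'i set) \<Rightarrow> (nat \<Rightarrow> 'i \<Rightarrow> 'i) \<Rightarrow> nat
    \<Rightarrow> ('i list \<times> 'a set \<times> 'b set) set set" where
  "codes I p n = {T. (\<forall>t\<in>T. length (fst t) \<le> Suc n) \<and>
     (\<forall>k\<le>n. finite (level T k) \<and> level T k \<subseteq> I k) \<and>
     (\<forall>k<n. p k ` level T (Suc k) \<subseteq> level T k)}"

lemma level_restrict: "k \<le> n \<Longrightarrow> level (restrict_levels n T) k = level T k"
  by (simp add: level_def restrict_levels_def)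

text \<open>Level \<open>n\<close> is stored in lists of length \<open>n + 1\<close>, so the bound
  on lengths leaves it vacant in \<open>T\<close>.\<close>

lemma level_extend:
  assumes "\<forall>t\<in>T. length (fst t) \<le> n"
  shows "level (extend n T E) k = (if k = n then E else level T k)"
proof -
  have "(replicate (Suc n) \<alpha>, {}, {}) \<notin> T" for \<alpha>
    using assms by force
  moreover have "replicate (Suc k) \<alpha> = replicate (Suc n) \<beta> \<longleftrightarrow> k = n \<and> \<alpha> = \<beta>" for \<alpha> \<beta> :: 'c
    by (auto dest: arg_cong[of _ _ length])
  ultimately show ?thesis
    unfolding level_def extend_def by (auto simp del: replicate_Suc)
qed

lemma restrict_codes:
  assumes T: "T \<in> codes I p (Suc n)"
  shows "restrict_levels n T \<in> codes I p n"
  unfolding codes_def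
proof (intro CollectI conjI allI impI)
  show "\<forall>t\<in>restrict_levels n T. length (fst t) \<le> Suc n"
    by (simp add: restrict_levels_def)
qed (use T in \<open>simp_all add: codes_def level_restrict\<close>)

lemma restrict_extend:
  assumes "\<forall>t\<in>T. length (fst t) \<le> Suc n"
  shows "restrict_levels n (extend (Suc n) T E) = T"
proof (intro set_eqI iffI)
  fix t assume "t \<in> T"
  then show "t \<in> restrict_levels n (extend (Suc n) T E)"
    using assms by (simp add: restrict_levels_def extend_def)
next
  fix t assume "t \<in> restrict_levels n (extend (Suc n) T E)"
  then show "t \<in> T"
    by (auto simp: restrict_levels_def extend_def)
qed

text \<open>Along a chain of codes the last levels are finite sets \<open>E\<^sub>n\<close>
  containing the parents of \<open>E\<^sub>n\<^sub>+\<^sub>1\<close>. Hence their unions form a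
  complete sequence in \<open>X\<close>, and the images under \<open>s\<close> form one in
  \<open>Y\<close>.\<close>

lemma sieve_complete_target:
  assumes S: "complete_sieve X (I :: nat \<Rightarrow> 'i set) U p"
  shows "sieve_complete_with Y TYPE(('i list \<times> 'a set \<times> 'b set) set)"
proof -
  have sv: "is_sieve X I U p" using S unfolding complete_sieve_def by blast
  \<comment> \<open>Only the last level of a code enters its set; the earlier levels name the
    ancestors.\<close>
  define W where "W n T = (\<Union>\<alpha>\<in>level T n. U n \<alpha>)" for n and T :: "('i list \<times> 'a set \<times> 'b set) set"
  define V where "V n T = s (W n T)" for n T
  let ?J = "codes I p" and ?q = "restrict_levels :: nat \<Rightarrow> ('i list \<times> 'a set \<times> 'b set) set \<Rightarrow> _"
  have levelI: "finite (level T n)" "level T n \<subseteq> I n" if "T \<in> ?J n" for T n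
    using that by (auto simp: codes_def)
  have openW: "openin X (W n T)" if "T \<in> ?J n" for n T
    unfolding W_def using levelI(2)[OF that] sieve_openin[OF sv] by blast
  have level_step: "p n ` level T (Suc n) \<subseteq> level (?q n T) n" if "T \<in> ?J (Suc n)" for T n
    using that by (simp add: codes_def level_restrict)
  have V_antimono: "V (Suc n) T \<subseteq> V n (?q n T)" if T: "T \<in> ?J (Suc n)" for n T
    unfolding V_def
  proof (intro s_mono openW T restrict_codes)
    have "U (Suc n) \<beta> \<subseteq> U n (p n \<beta>)" if "\<beta> \<in> level T (Suc n)" for \<beta>
      using sieve_subset_parent[OF sv] levelI(2)[OF T] that by blast
    then show "W (Suc n) T \<subseteq> W n (?q n T)"
      using level_step[OF T] unfolding W_def by fastforce
  qed
  have V_extend: "\<exists>S\<in>?J (Suc n). ?q n S = T \<and> y \<in> V (Suc n) S" if T: "T \<in> ?J n" and y: "y \<in> V n T" for n T y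
  proof -
    obtain E where E: "finite E" "E \<subseteq> I (Suc n)" "p n ` E \<subseteq> level T n"
      "y \<in> s (\<Union>\<beta>\<in>E. U (Suc n) \<beta>)"
      using sieve_step[OF sv levelI(2)[OF T] y[unfolded V_def W_def]] by blast
    let ?S = "extend (Suc n) T E"
    have len: "\<forall>t\<in>T. length (fst t) \<le> Suc n"
      using T by (simp add: codes_def)
    note lev = level_extend[OF len, of E]
    have "?S \<in> ?J (Suc n)"
      unfolding codes_def
    proof (intro CollectI conjI allI impI ballI)
      show "length (fst t) \<le> Suc (Suc n)" if "t \<in> ?S" for t
        using len that by (auto simp: extend_def)
      show "finite (level ?S k)" "level ?S k \<subseteq> I k" if "k \<le> Suc n" for k
        using that T E by (auto simp: lev codes_def le_Suc_eq)
      show "p k ` level ?S (Suc k) \<subseteq> level ?S k" if "k < Suc n" for k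
      proof (cases "k = n")
        case False
        then have "p k ` level T (Suc k) \<subseteq> level T k"
          using that T unfolding codes_def by simp
        then show ?thesis using that False by (simp add: lev)
      qed (use E(3) in \<open>simp add: lev\<close>)
    qed
    moreover have "y \<in> V (Suc n) ?S"
      using E(4) by (simp add: V_def W_def lev)
    ultimately show ?thesis
      using restrict_extend[OF len, of E] by (intro bexI[of _ ?S] conjI)
  qed
  have V_cover: "\<exists>T\<in>?J n. y \<in> V n T" if y: "y \<in> topspace Y" for n y
  proof (induction n)
    case 0
    obtain E where E: "finite E" "E \<subseteq> I 0" "y \<in> s (\<Union>\<alpha>\<in>E. U 0 \<alpha>)"
      using sieve_start[OF sv y] by blast
    have lev: "level (extend 0 {} E) k = (if k = 0 then E else level {} k)" for k
      by (rule level_extend) simp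
    have "extend 0 {} E \<in> ?J 0"
      using E unfolding codes_def by (auto simp: lev) (auto simp: extend_def)
    then show ?case
      using E(3) by (intro bexI[of _ "extend 0 {} E"]) (simp_all add: V_def W_def lev)
  next
    case (Suc n)
    then show ?case using V_extend by meson
  qed
  have "is_sieve Y ?J V ?q"
    unfolding is_sieve_def
  proof (intro conjI allI ballI)
    show openV: "openin Y (V n T)" if "T \<in> ?J n" for n T
      unfolding V_def by (intro s_open openW that)
    show "\<Union>(V n ` ?J n) = topspace Y" for n
      using V_cover openV[THEN openin_subset] by blast
    show "?q n T \<in> ?J n" if "T \<in> ?J (Suc n)" for n T
      using that by (rule restrict_codes)
    show "V n T = \<Union>{V (Suc n) S |S. S \<in> ?J (Suc n) \<and> ?q n S = T}" if "T \<in> ?J n" for n T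
    proof
      show "V n T \<subseteq> \<Union>{V (Suc n) S |S. S \<in> ?J (Suc n) \<and> ?q n S = T}"
        using V_extend[OF that] by blast
      show "\<Union>{V (Suc n) S |S. S \<in> ?J (Suc n) \<and> ?q n S = T} \<subseteq> V n T"
        using V_antimono by blast
    qed
  qed
  moreover have "\<exists>y\<in>topspace Y. \<forall>B\<in>\<B>. y \<in> Y closure_of B"
    if c: "pi_chain ?J ?q c" and \<B>: "filter_base_on Y \<B>" "\<forall>B\<in>\<B>. \<forall>n. B \<inter> V n (c n) \<noteq> {}" for c \<B>
  proof -
    have cJ: "c n \<in> ?J n" and cq: "?q n (c (Suc n)) = c n" for n
      using c by (auto simp: pi_chain_def)
    have "complete_seq X (\<lambda>n. W n (c n))"
      unfolding W_def using levelI[OF cJ] level_step[OF cJ]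
      by (intro complete_sieve_finite_unions[OF S]) (auto simp: cq)
    then have "complete_seq Y (\<lambda>n. V n (c n))"
      unfolding V_def using openW[OF cJ] by (rule complete_seq_image)
    then show ?thesis
      using \<B> unfolding complete_seq_def by blast
  qed
  ultimately have "complete_sieve Y ?J V ?q"
    unfolding complete_sieve_def by blast
  then show ?thesis
    unfolding sieve_complete_with_def by blast
qed

end

section \<open>The Lindelof number\<close>

lemma lepoll_UN_infinite:
  fixes A :: "'c \<Rightarrow> 'd set"
  assumes "infinite K" "I \<lesssim> K" "\<And>i. i \<in> I \<Longrightarrow> A i \<lesssim> K"
  shows "(\<Union>i\<in>I. A i) \<lesssim> K"
proof -
  have *: "B \<lesssim> K \<longleftrightarrow> (card_of B, card_of K) \<in> ordLeq" for B :: "'d set"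
    by (simp add: lepoll_def card_of_ordLeq)
  have "(card_of I, card_of K) \<in> ordLeq"
    using assms(2) by (simp add: lepoll_def card_of_ordLeq)
  then show ?thesis
    using assms(1,3) unfolding * by (intro card_of_UNION_ordLeq_infinite) auto
qed

text \<open>A set of size \<open>n + 1\<close> arises from one of size \<open>n\<close> by inserting
  a point, so induction bounds the subsets of each size, and there are only countably many
  sizes.\<close>

lemma lepoll_finite_subsets:
  assumes K: "infinite K" and A: "A \<lesssim> K"
  shows "{E. finite E \<and> E \<subseteq> A} \<lesssim> K"
proof -
  let ?S = "\<lambda>n. {E. finite E \<and> E \<subseteq> A \<and> card E = n}"
  have S: "?S n \<lesssim> K" for n
  proof (induction n)
    case 0
    have "?S 0 \<subseteq> {{}}" by auto
    then show ?case
      by (meson K finite.emptyI finite.insertI finite_lepoll_infinite finite_subset)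
  next
    case (Suc n)
    have "E \<in> (\<Union>a\<in>A. insert a ` ?S n)" if "E \<in> ?S (Suc n)" for E
    proof -
      from that obtain a E' where E': "E = insert a E'" "a \<notin> E'" "card E' = n"
        by (auto simp: card_Suc_eq)
      then show ?thesis using that by auto
    qed
    then have "?S (Suc n) \<subseteq> (\<Union>a\<in>A. insert a ` ?S n)" by blast
    moreover have "(\<Union>a\<in>A. insert a ` ?S n) \<lesssim> K"
      using image_lepoll Suc.IH by (intro lepoll_UN_infinite K A) (rule lepoll_trans)
    ultimately show ?case
      by (rule lepoll_trans[OF subset_imp_lepoll])
  qed
  have "{E. finite E \<and> E \<subseteq> A} = (\<Union>n\<in>UNIV. ?S n)" by auto
  moreover have "(\<Union>n\<in>UNIV. ?S n) \<lesssim> K"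
    using K S by (intro lepoll_UN_infinite) (auto simp: infinite_le_lepoll)
  ultimately show ?thesis by simp
qed

section \<open>Thinning a sieve to the Lindelof number\<close>

text \<open>By regularity each point of \<open>C\<close> has an open neighbourhood whose closure
  lies in some \<open>U \<beta>\<close>. Together with the complement of \<open>C\<close> these sets
  cover \<open>X\<close>, so the Lindelof bound applies; the second component of a pair in
  \<open>Q\<close> remembers a suitable \<open>\<beta>\<close>.\<close>

lemma lindelof_le_closed_shrink:
  assumes X: "regular_space X" and K: "lindelof_le X K" and C: "closedin X C"
    and U: "\<And>\<beta>. \<beta> \<in> B \<Longrightarrow> openin X (U \<beta>)" "C \<subseteq> (\<Union>\<beta>\<in>B. U \<beta>)"
  shows "\<exists>Q. Q \<lesssim> K \<and> (\<forall>w\<in>Q. snd w \<in> B \<and> openin X (fst w) \<and> X closure_of fst w \<subseteq> U (snd w)) \<and>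
    C \<subseteq> (\<Union>w\<in>Q. fst w)"
proof -
  define \<U> where "\<U> = {G. openin X G \<and> (\<exists>\<beta>\<in>B. X closure_of G \<subseteq> U \<beta>)}"
  have "\<exists>G\<in>\<U>. x \<in> G" if x: "x \<in> C" for x
  proof -
    obtain \<beta> where \<beta>: "\<beta> \<in> B" "x \<in> U \<beta>" using U(2) x by blast
    have "closedin X (topspace X - U \<beta>)" "x \<in> topspace X - (topspace X - U \<beta>)"
      using U(1)[OF \<beta>(1)] \<beta>(2) openin_subset by auto
    then obtain G where G: "openin X G" "x \<in> G" "disjnt (topspace X - U \<beta>) (X closure_of G)"
      using X unfolding regular_space by meson
    then have "X closure_of G \<subseteq> U \<beta>"
      using closure_of_subset_topspace[of X G] by (auto simp: disjnt_iff)
    then show ?thesis using G \<beta> by (auto simp: \<U>_def)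
  qed
  then have "topspace X \<subseteq> \<Union>(insert (topspace X - C) \<U>)" by blast
  moreover have "\<forall>G\<in>insert (topspace X - C) \<U>. openin X G"
    using C by (auto simp: \<U>_def)
  ultimately obtain \<V> where \<V>: "\<V> \<subseteq> insert (topspace X - C) \<U>" "topspace X \<subseteq> \<Union>\<V>" "\<V> \<lesssim> K"
    using K unfolding lindelof_le_def by meson
  have "\<forall>G\<in>\<U>. \<exists>\<beta>. \<beta> \<in> B \<and> X closure_of G \<subseteq> U \<beta>"
    by (auto simp: \<U>_def)
  then obtain b where b: "\<And>G. G \<in> \<U> \<Longrightarrow> b G \<in> B \<and> X closure_of G \<subseteq> U (b G)"
    by metis
  define Q where "Q = (\<lambda>G. (G, b G)) ` (\<V> \<inter> \<U>)"
  have "Q \<lesssim> \<V>"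
    unfolding Q_def by (rule subset_image_lepoll[where f = "\<lambda>G. (G, b G)"]) blast
  then have "Q \<lesssim> K"
    using \<V>(3) by (rule lepoll_trans)
  moreover have "\<forall>w\<in>Q. snd w \<in> B \<and> openin X (fst w) \<and> X closure_of fst w \<subseteq> U (snd w)"
    using b by (auto simp: Q_def \<U>_def)
  moreover have "C \<subseteq> (\<Union>w\<in>Q. fst w)"
  proof
    fix x assume x: "x \<in> C"
    then obtain G where "G \<in> \<V>" "x \<in> G"
      using \<V>(2) closedin_subset[OF C] by blast
    moreover from this have "G \<in> \<U>" using \<V>(1) x by blast
    ultimately show "x \<in> (\<Union>w\<in>Q. fst w)" by (auto simp: Q_def)
  qed
  ultimately show ?thesis by blast
qed

text \<open>The members of a sieve need not inherit the bound on the Lindelof number, but their closures do. A node of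
  the thinned sieve is therefore an open set whose closure lies in a member of the old one.\<close>

lemma lindelof_le_thin_sieve:
  fixes X :: "'a topology" and I :: "nat \<Rightarrow> 'i set"
  assumes X: "regular_space X" and K: "infinite K" "lindelof_le X K" and S: "complete_sieve X I U p"
  shows "\<exists>(J :: nat \<Rightarrow> ('a set \<times> 'i) list set) V q. complete_sieve X J V q \<and> (\<forall>n. J n \<lesssim> K)"
proof -
  have sv: "is_sieve X I U p" using S unfolding complete_sieve_def by blast
  define valid where "valid n v \<longleftrightarrow> snd v \<in> I n \<and> openin X (fst v) \<and> X closure_of fst v \<subseteq> U n (snd v)"
    for n and v :: "'a set \<times> 'i"
  have "topspace X \<subseteq> (\<Union>\<alpha>\<in>I 0. U 0 \<alpha>)"
    using sv unfolding is_sieve_def by (elim conjE) simp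
  then obtain Q where Q: "Q \<lesssim> K" "\<And>v. v \<in> Q \<Longrightarrow> valid 0 v" "topspace X \<subseteq> (\<Union>v\<in>Q. fst v)"
    using lindelof_le_closed_shrink[OF X K(2) closedin_topspace, of "I 0" "U 0"] sieve_openin[OF sv]
    unfolding valid_def by meson
  have "\<exists>R. R \<lesssim> K \<and> (\<forall>w\<in>R. valid (Suc n) w \<and> p n (snd w) = snd v) \<and> fst v = (\<Union>w\<in>R. fst w)"
    if v: "valid n v" for n v
  proof -
    let ?B = "{\<beta> \<in> I (Suc n). p n \<beta> = snd v}"
    have "U n (snd v) = \<Union>{U (Suc n) \<beta> | \<beta>. \<beta> \<in> I (Suc n) \<and> p n \<beta> = snd v}"
      using sv v unfolding is_sieve_def valid_def by blast
    then have "X closure_of fst v \<subseteq> (\<Union>\<beta>\<in>?B. U (Suc n) \<beta>)"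
      using v unfolding valid_def by blast
    then obtain R where R: "R \<lesssim> K" "X closure_of fst v \<subseteq> (\<Union>w\<in>R. fst w)"
      "\<And>w. w \<in> R \<Longrightarrow> snd w \<in> ?B \<and> openin X (fst w) \<and> X closure_of fst w \<subseteq> U (Suc n) (snd w)"
      using lindelof_le_closed_shrink[OF X K(2) closedin_closure_of, of ?B "U (Suc n)"]
        sieve_openin[OF sv] by (metis (no_types, lifting) mem_Collect_eq)
    \<comment> \<open>Intersecting with \<open>fst v\<close> makes the union of the children exactly
      \<open>fst v\<close>, as a sieve demands, and the closures only shrink.\<close>
    define R' where "R' = (\<lambda>w. (fst w \<inter> fst v, snd w)) ` R"
    have "R' \<lesssim> K"
      unfolding R'_def using image_lepoll R(1) by (rule lepoll_trans)
    moreover have "valid (Suc n) w \<and> p n (snd w) = snd v" if "w \<in> R'" for w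
    proof -
      obtain u where u: "u \<in> R" "w = (fst u \<inter> fst v, snd u)"
        using \<open>w \<in> R'\<close> by (auto simp: R'_def)
      have "X closure_of (fst u \<inter> fst v) \<subseteq> X closure_of fst u"
        by (intro closure_of_mono) auto
      then show ?thesis
        using R(3)[OF u(1)] v unfolding valid_def u(2) by auto
    qed
    moreover have "fst v \<subseteq> X closure_of fst v"
      using v unfolding valid_def by (intro closure_of_subset openin_subset) blast
    then have "fst v = (\<Union>w\<in>R'. fst w)"
      using R(2) unfolding R'_def by auto
    ultimately show ?thesis by blast
  qed
  then obtain ch where ch: "\<And>n v. valid n v \<Longrightarrow> ch n v \<lesssim> K"
    "\<And>n v w. \<lbrakk>valid n v; w \<in> ch n v\<rbrakk> \<Longrightarrow> valid (Suc n) w \<and> p n (snd w) = snd v"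
    "\<And>n v. valid n v \<Longrightarrow> fst v = (\<Union>w\<in>ch n v. fst w)"
    by metis
  \<comment> \<open>Indices are paths with the newest node first, so that the parent map is
    \<open>tl\<close> and a node reached along different paths counts separately.\<close>
  define J where "J = rec_nat ((\<lambda>v. [v]) ` Q) (\<lambda>n L. \<Union>l\<in>L. (\<lambda>w. w # l) ` ch n (hd l))"
  have J0: "J 0 = (\<lambda>v. [v]) ` Q" and JS: "J (Suc n) = (\<Union>l\<in>J n. (\<lambda>w. w # l) ` ch n (hd l))" for n
    by (simp_all add: J_def)
  have val: "valid n (hd l)" if "l \<in> J n" for n l
    using that
  proof (induction n arbitrary: l)
    case 0 then show ?case using Q(2) by (auto simp: J0)
  next
    case (Suc n)
    then obtain l' w where "l' \<in> J n" "w \<in> ch n (hd l')" "l = w # l'" by (auto simp: JS)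
    then show ?case using ch(2)[OF Suc.IH[of l'], of w] by simp
  qed
  have JK: "J n \<lesssim> K" for n
  proof (induction n)
    case 0 show ?case unfolding J0 using image_lepoll Q(1) by (rule lepoll_trans)
  next
    case (Suc n)
    show ?case
      unfolding JS using image_lepoll ch(1)[OF val]
      by (intro lepoll_UN_infinite K Suc.IH) (rule lepoll_trans)
  qed
  define V where "V n l = fst (hd l)" for n :: nat and l :: "('a set \<times> 'i) list"
  have JS_iff: "m \<in> J (Suc n) \<longleftrightarrow> (\<exists>w l. m = w # l \<and> l \<in> J n \<and> w \<in> ch n (hd l))" for m n
    by (auto simp: JS)
  have V_eq: "V n l = \<Union>{V (Suc n) m | m. m \<in> J (Suc n) \<and> tl m = l}" if l: "l \<in> J n" for n l
  proof -
    have "{V (Suc n) m | m. m \<in> J (Suc n) \<and> tl m = l} = fst ` ch n (hd l)"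
      using l unfolding V_def JS_iff by (force simp: image_iff)
    then show ?thesis using ch(3)[OF val[OF l]] by (simp add: V_def)
  qed
  have V_open: "openin X (V n l)" and V_sub: "V n l \<subseteq> U n (snd (hd l))" if "l \<in> J n" for n l
  proof -
    show o: "openin X (V n l)" using val[OF that] by (simp add: V_def valid_def)
    have "V n l \<subseteq> X closure_of V n l" by (intro closure_of_subset openin_subset o)
    then show "V n l \<subseteq> U n (snd (hd l))" using val[OF that] by (auto simp: V_def valid_def)
  qed
  have V_cover: "topspace X \<subseteq> (\<Union>l\<in>J n. V n l)" for n
  proof (induction n)
    case 0 then show ?case using Q(3) by (simp add: J0 V_def)
  next
    case (Suc n)
    have "V n l \<subseteq> (\<Union>m\<in>J (Suc n). V (Suc n) m)" if "l \<in> J n" for l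
      unfolding V_eq[OF that] by blast
    then show ?case using Suc.IH by blast
  qed
  have "is_sieve X J V (\<lambda>_. tl)"
    unfolding is_sieve_def
  proof (intro conjI allI ballI V_open V_eq)
    show "\<Union>(V n ` J n) = topspace X" for n
      using V_cover[of n] V_open[THEN openin_subset] by blast
    show "tl m \<in> J n" if "m \<in> J (Suc n)" for n m
      using that unfolding JS_iff by auto
  qed
  moreover have "\<exists>x\<in>topspace X. \<forall>B\<in>\<B>. x \<in> X closure_of B"
    if c: "pi_chain J (\<lambda>_. tl) c" and \<B>: "filter_base_on X \<B>" "\<forall>B\<in>\<B>. \<forall>n. B \<inter> V n (c n) \<noteq> {}" for c \<B>
  proof (rule complete_sieveD[OF S _ \<B>(1)])
    have cJ: "c n \<in> J n" and tl: "tl (c (Suc n)) = c n" for n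
      using c by (auto simp: pi_chain_def)
    \<comment> \<open>The old indices along a new chain form a chain of the old sieve. Its sets
      contain the new ones, so the filter base meshes with them too.\<close>
    have "p n (snd (hd (c (Suc n)))) = snd (hd (c n))" for n
    proof -
      obtain w where "c (Suc n) = w # c n" "w \<in> ch n (hd (c n))"
        using cJ[of "Suc n"] tl[of n] unfolding JS_iff by auto
      then show ?thesis using ch(2)[OF val[OF cJ]] by simp
    qed
    then show "pi_chain I p (\<lambda>n. snd (hd (c n)))"
      using val[OF cJ] by (simp add: pi_chain_def valid_def)
    show "\<forall>B\<in>\<B>. \<forall>n. B \<inter> U n (snd (hd (c n))) \<noteq> {}"
      using \<B>(2) V_sub[OF cJ] by blast
  qed
  ultimately have "complete_sieve X J V (\<lambda>_. tl)"
    unfolding complete_sieve_def by blast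
  then show ?thesis using JK by blast
qed

section \<open>The Lindelof number of the target\<close>

context mono_set_tri_quotient
begin

text \<open>Each point of \<open>Y\<close> uses a sequence of its own, but only the pairs of a level
  \<open>n\<close> and a finite \<open>E \<subseteq> I n\<close> are counted, and the size of
  \<open>K\<close> bounds their number.\<close>

lemma lindelof_le_target:
  assumes K: "infinite K" and S: "complete_sieve X I U p" and IK: "\<And>n. I n \<lesssim> K"
  shows "lindelof_le Y K"
  unfolding lindelof_le_def
proof (intro allI impI)
  fix \<V> assume \<V>: "(\<forall>V\<in>\<V>. openin Y V) \<and> topspace Y \<subseteq> \<Union>\<V>"
  have sv: "is_sieve X I U p" using S unfolding complete_sieve_def by blast
  define W where "W n E = (\<Union>\<alpha>\<in>E. U n \<alpha>)" for n E
  define small where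
    "small n E \<longleftrightarrow> (\<exists>\<F>. finite \<F> \<and> \<F> \<subseteq> \<V> \<and> s (W n E) \<subseteq> \<Union>\<F>)" for n E
  then obtain f where
    f: "\<And>n E. small n E \<Longrightarrow> finite (f n E) \<and> f n E \<subseteq> \<V> \<and> s (W n E) \<subseteq> \<Union>(f n E)"
    using that[of "\<lambda>n E. SOME \<F>. finite \<F> \<and> \<F> \<subseteq> \<V> \<and> s (W n E) \<subseteq> \<Union>\<F>"]
    by (metis (no_types, lifting) someI_ex)
  define \<E> where "\<E> n = {E. (finite E \<and> E \<subseteq> I n) \<and> small n E}" for n
  define \<V>' where "\<V>' = (\<Union>n\<in>UNIV. \<Union>E\<in>\<E> n. f n E)"
  have "\<V>' \<lesssim> K"
    unfolding \<V>'_def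
  proof (intro lepoll_UN_infinite K)
    show "(UNIV :: nat set) \<lesssim> K" using K by (simp add: infinite_le_lepoll)
    show "\<E> n \<lesssim> K" for n
      by (rule lepoll_trans[OF subset_imp_lepoll lepoll_finite_subsets[OF K IK[of n]]])
        (auto simp: \<E>_def)
    show "f n E \<lesssim> K" if "E \<in> \<E> n" for n E
      using f that K by (auto simp: \<E>_def intro: finite_lepoll_infinite)
  qed
  moreover have "\<V>' \<subseteq> \<V>"
    using f unfolding \<V>'_def \<E>_def by blast
  moreover have "y \<in> \<Union>\<V>'" if y: "y \<in> topspace Y" for y
  proof -
    have "\<exists>E. \<forall>n. (finite (E n) \<and> E n \<subseteq> I n \<and> y \<in> s (W n (E n))) \<and> p n ` E (Suc n) \<subseteq> E n"
    proof (rule dependent_nat_choice)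
      show "\<exists>E. finite E \<and> E \<subseteq> I 0 \<and> y \<in> s (W 0 E)"
        unfolding W_def by (rule sieve_start[OF sv y])
      show "\<exists>E'. (finite E' \<and> E' \<subseteq> I (Suc n) \<and> y \<in> s (W (Suc n) E')) \<and> p n ` E' \<subseteq> E"
        if "finite E \<and> E \<subseteq> I n \<and> y \<in> s (W n E)" for E n
        using sieve_step[OF sv, of E n y] that unfolding W_def by blast
    qed
    then obtain E where E: "\<And>n. finite (E n)" "\<And>n. E n \<subseteq> I n" "\<And>n. y \<in> s (W n (E n))"
      "\<And>n. p n ` E (Suc n) \<subseteq> E n" by blast
    have cs: "complete_seq X (\<lambda>n. W n (E n))"
      unfolding W_def using S E(1,2,4) by (rule complete_sieve_finite_unions)
    have op: "openin X (W n (E n))" for n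
      unfolding W_def using sieve_openin[OF sv] E(2) by blast
    \<comment> \<open>Finitely many members of \<open>\<V>\<close> cover the compact core. Some
      \<open>s (W n (E n))\<close> lies in their union, which makes \<open>E n\<close> small at
      level \<open>n\<close>.\<close>
    have cpt: "compactin Y (core Y (\<lambda>n. s (W n (E n))))"
      using cs op by (rule compactin_core_image)
    moreover have "core Y (\<lambda>n. s (W n (E n))) \<subseteq> \<Union>\<V>"
      using compactin_subset_topspace[OF cpt] \<V> by blast
    ultimately obtain \<F> where \<F>: "finite \<F>" "\<F> \<subseteq> \<V>" "core Y (\<lambda>n. s (W n (E n))) \<subseteq> \<Union>\<F>"
      using \<V> unfolding compactin_def by meson
    have "openin Y (\<Union>\<F>)" using \<V> \<F>(2) by blast
    then obtain n where "s (W n (E n)) \<subseteq> \<Union>\<F>"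
      using image_eventually_subset[OF cs op _ \<F>(3)] by blast
    then have sm: "small n (E n)" using \<F> unfolding small_def by blast
    then have "y \<in> \<Union>(f n (E n))" using f E(3) by blast
    moreover have "E n \<in> \<E> n" using E(1,2) sm by (simp add: \<E>_def)
    ultimately show ?thesis unfolding \<V>'_def by blast
  qed
  ultimately show "\<exists>\<V>'\<subseteq>\<V>. topspace Y \<subseteq> \<Union>\<V>' \<and> \<V>' \<lesssim> K" by blast
qed

end

theorem theorem1p4:
  fixes X :: "'a topology" and Y :: "'b topology" and F :: "'a set \<Rightarrow> 'b set"
  assumes "tychonoff X" and "tychonoff Y"
    and "sieve_complete_with X TYPE('i)"
    and "mu_space Y"
    and "maps_compacts X Y F"
    and "monotone_on_compacts X F"
    and "set_tri_quotient X Y F"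
  shows "sieve_complete_with Y TYPE(('i list \<times> 'a set \<times> 'b set) set) \<and>
    (\<forall>K :: 'c set. infinite K \<and> lindelof_le X K \<longrightarrow> lindelof_le Y K)"
proof -
  have reg: "regular_space X"
    using assms(1) by (simp add: tychonoff_def completely_regular_imp_regular_space)
  from assms(7) obtain s where
    s: "\<forall>U. openin X U \<longrightarrow> openin Y (s U)"
      "\<forall>U. openin X U \<longrightarrow> s U \<subseteq> \<Union>{F K | K. compactin X K \<and> K \<subseteq> U}"
      "s (topspace X) = topspace Y"
      "\<forall>U V. openin X U \<and> openin X V \<and> U \<subseteq> V \<longrightarrow> s U \<subseteq> s V"
      "\<forall>U y \<W>. openin X U \<and> y \<in> s U \<and> (\<forall>W\<in>\<W>. openin X W) \<and>
        \<Union>{K. compactin X K \<and> y \<in> F K \<and> K \<subseteq> U} \<subseteq> \<Union>\<W> \<longrightarrow>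
        (\<exists>\<E>. finite \<E> \<and> \<E> \<subseteq> \<W> \<and> y \<in> s (\<Union>\<E>))"
    unfolding set_tri_quotient_def by (elim exE conjE) (rule that)
  interpret mono_set_tri_quotient X Y F s
  proof (rule mono_set_tri_quotient.intro[OF reg assms(4-6)])
    show "openin Y (s U)" if "openin X U" for U
      using s(1) that by simp
    show "s U \<subseteq> \<Union>{F K | K. compactin X K \<and> K \<subseteq> U}" if "openin X U" for U
      by (rule s(2)[rule_format, OF that])
    show "s U \<subseteq> s V" if "openin X U" "openin X V" "U \<subseteq> V" for U V
      using s(4) that by simp
    show "\<exists>\<E>. finite \<E> \<and> \<E> \<subseteq> \<W> \<and> y \<in> s (\<Union>\<E>)"
      if "openin X U" "y \<in> s U" "\<forall>W\<in>\<W>. openin X W"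
        "\<Union>{K. compactin X K \<and> y \<in> F K \<and> K \<subseteq> U} \<subseteq> \<Union>\<W>" for U y \<W>
      by (rule s(5)[THEN spec[of _ U], THEN spec[of _ y], THEN spec[of _ \<W>], THEN mp]) (intro conjI that)
  qed (fact s(3))
  obtain I U p where S: "complete_sieve X (I :: nat \<Rightarrow> 'i set) U p"
    using assms(3) unfolding sieve_complete_with_def by blast
  \<comment> \<open>The thinned sieve depends on \<open>K\<close> and serves the Lindelof bound; the
    index type claimed for \<open>Y\<close> comes from the original sieve.\<close>
  have "lindelof_le Y K" if K: "infinite K" "lindelof_le X K" for K :: "'c set"
    using lindelof_le_thin_sieve[OF reg K S] lindelof_le_target[OF K(1)] by blast
  then show ?thesis
    using sieve_complete_target[OF S] by blast
qed

end
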